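(* Let $\mathcal{H}$ be a $k$-uniform hypergraph with $n$ vertices and $m\ge1$ edges, and let $\mathbf{A}_\mathcal{L}$ be the adjacency matrix of its line multigraph. (a) If $m=n$, then $\mathtt{QE}(\mathcal{H})=\mathtt{E}(\mathbf{A}_\mathcal{L})$. (b) If $m<n$, then $\mathtt{QE}(\mathcal{H})-\frac{2km(n-m)}{n}\le \mathtt{E}(\mathbf{A}_\mathcal{L}) < \mathtt{QE}(\mathcal{H})$, and the first inequality is an equality if and only if the edges of $\mathcal{H}$ are pairwise disjoint. (c) If $m>n$, then $\mathtt{QE}(\mathcal{H})<\mathtt{E}(\mathbf{A}_\mathcal{L})<\mathtt{QE}(\mathcal{H})+2k(m-n)$.
   Context: A hypergraph $\mathcal{H}=(V,E)$ with $|V|=n$, $|E|=m$ is $k$-uniform ($k\ge2$) if every edge has exactly $k$ vertices. Its incidence matrix $\mathbf{B}$ is the $n\times m$ matrix with $b(v,e)=1$ if $v\in e$ and $0$ otherwise; the signless Laplacian matrix is $\mathbf{Q}=\mathbf{B}\mathbf{B}^T$. The average degree is $d(\mathcal{H})=km/n$. The signless Laplacian energy is $\mathtt{QE}(\mathcal{H})=\sum_{i=1}^n|\lambda_i(\mathbf{Q})-d(\mathcal{H})|$. The line multigraph $\mathcal{L}(\mathcal{H})$ has vertex set $E$, and the number of edges between distinct $e,f\in E$ is $|e\cap f|$; its adjacency matrix $\mathbf{A}_\mathcal{L}$ is the $m\times m$ matrix with entry $|e\cap f|$ for $e\ne f$ and $0$ on the diagonal (so $\mathbf{B}^T\mathbf{B}=k\mathbf{I}+\mathbf{A}_\mathcal{L}$).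 For a symmetric matrix $\mathbf{M}$, $\mathtt{E}(\mathbf{M})$ is the sum of absolute values of its eigenvalues. *)

theory Defs
  imports
    "HOL-Computational_Algebra.Polynomial"
    "Jordan_Normal_Form.Char_Poly"
begin

definition uniform_hypergraph :: "nat \<Rightarrow> 'a set \<Rightarrow> 'a set set \<Rightarrow> bool" where
  "uniform_hypergraph k V E \<longleftrightarrow>
     k \<ge> 2 \<and> finite V \<and> (\<forall>e\<in>E. e \<subseteq> V \<and> card e = k)"

(* Matrices are indexed by natural numbers, so the vertices and the edges are listed
   without repetition; the spectra do not depend on the chosen lists. *)
definition enumeration :: "'b list \<Rightarrow> 'b set \<Rightarrow> bool" where
  "enumeration xs A \<longleftrightarrow> distinct xs \<and> set xs = A"

definition incidence_matrix :: "'a list \<Rightarrow> 'a set list \<Rightarrow> real mat" where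
  "incidence_matrix vs es =
     mat (length vs) (length es) (\<lambda>(i, j). if vs ! i \<in> es ! j then 1 else 0)"

definition signless_laplacian :: "'a list \<Rightarrow> 'a set list \<Rightarrow> real mat" where
  "signless_laplacian vs es = incidence_matrix vs es * (incidence_matrix vs es)\<^sup>T"

definition line_adjacency_matrix :: "'a set list \<Rightarrow> real mat" where
  "line_adjacency_matrix es =
     mat (length es) (length es)
       (\<lambda>(i, j). if i = j then 0 else real (card (es ! i \<inter> es ! j)))"

(* Real eigenvalues with algebraic multiplicity. For a real symmetric matrix these
   are all eigenvalues, and there are as many of them as rows. *)
definition eigenvalues :: "real mat \<Rightarrow> real multiset" where
  "eigenvalues M = proots (char_poly M)"

definition matrix_energy :: "real mat \<Rightarrow> real" where
  "matrix_energy M = (\<Sum>x\<in>#eigenvalues M. \<bar>x\<bar>)"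

definition average_degree :: "nat \<Rightarrow> 'a list \<Rightarrow> 'a set list \<Rightarrow> real" where
  "average_degree k vs es = real k * real (length es) / real (length vs)"

definition signless_laplacian_energy :: "nat \<Rightarrow> 'a list \<Rightarrow> 'a set list \<Rightarrow> real" where
  "signless_laplacian_energy k vs es =
     (\<Sum>x\<in>#eigenvalues (signless_laplacian vs es). \<bar>x - average_degree k vs es\<bar>)"

end

theory Submission
  imports Defs "Jordan_Normal_Form.Schur_Decomposition"
begin

text \<open>
  Let \<open>B\<close> be the incidence matrix. The spectra of \<open>Q = BB\<^sup>T\<close> and of
  \<open>B\<^sup>TB = kI + A\<close> differ only in \<open>\<bar>n - m\<bar>\<close> zeros, and their means are \<open>km/n\<close> and \<open>k\<close>. So the two
  energies are the total deviations of these spectra from their means, and the theorem compares a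
  multiset \<open>X\<close> having positive mean with \<open>X\<close> enlarged by zeros. The zeros lower the mean from
  \<open>a\<close> to \<open>b\<close> and contribute \<open>\<bar>X\<bar>(a - b)\<close>, which is also what the triangle inequality gives as a
  bound, in both directions, for the change in the deviation of \<open>X\<close>. Some element of \<open>X\<close>
  reaches \<open>a\<close>, so the total grows strictly; it grows by the maximal amount \<open>2\<bar>X\<bar>(a - b)\<close> only if no
  element lies below \<open>a\<close>, that is, if \<open>X\<close> is constant. The symmetric matrix with spectrum \<open>X\<close> is
  then scalar. For \<open>B\<^sup>TB\<close> this says that the edges are pairwise disjoint; for \<open>Q\<close> it is impossible,
  as two vertices of a common edge give a nonzero off-diagonal entry.
\<close>


section \<open>Deviation from the mean\<close>

lemma sum_mset_eq_iff_pointwise_eq: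
  fixes f g :: "'a \<Rightarrow> 'b :: linordered_ab_group_add"
  assumes "\<And>x. x \<in># X \<Longrightarrow> f x \<le> g x"
  shows "(\<Sum>x\<in>#X. f x) = (\<Sum>x\<in>#X. g x) \<longleftrightarrow> (\<forall>x\<in>#X. f x = g x)"
  using assms
proof (induction X)
  case (add a X)
  have "f a \<le> g a" "(\<Sum>x\<in>#X. f x) \<le> (\<Sum>x\<in>#X. g x)"
    using add.prems by (auto intro: sum_mset_mono)
  hence "f a + (\<Sum>x\<in>#X. f x) = g a + (\<Sum>x\<in>#X. g x) \<longleftrightarrow>
      f a = g a \<and> (\<Sum>x\<in>#X. f x) = (\<Sum>x\<in>#X. g x)"
    by (metis add_le_less_mono add_less_le_mono order_le_imp_less_or_eq order_less_irrefl)
  thus ?case using add by simp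
qed simp

definition mset_mean :: "'a :: field multiset \<Rightarrow> 'a" where
  "mset_mean X = \<Sum>\<^sub># X / of_nat (size X)"

definition total_deviation :: "'a :: linordered_field multiset \<Rightarrow> 'a" where
  "total_deviation X = (\<Sum>x\<in>#X. \<bar>x - mset_mean X\<bar>)"

lemma size_times_mset_mean:
  fixes X :: "'a :: field_char_0 multiset"
  shows "of_nat (size X) * mset_mean X = \<Sum>\<^sub># X"
proof (cases "X = {#}")
  case False
  hence "of_nat (size X) \<noteq> (0 :: 'a)" by simp
  thus ?thesis
    unfolding mset_mean_def times_divide_eq_right by (rule nonzero_mult_div_cancel_left)
qed simp

lemma all_ge_mset_mean_iff:
  fixes X :: "'a :: linordered_field multiset"
  shows "(\<forall>x\<in>#X. mset_mean X \<le> x) \<longleftrightarrow> (\<forall>x\<in>#X. x = mset_mean X)"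
  using sum_mset_eq_iff_pointwise_eq[of X "\<lambda>_. mset_mean X" "\<lambda>x. x"]
  by (auto simp: size_times_mset_mean)

lemma ex_ge_mset_mean:
  fixes X :: "'a :: linordered_field multiset"
  assumes "X \<noteq> {#}"
  obtains x where "x \<in># X" and "mset_mean X \<le> x"
proof (cases "\<forall>x\<in>#X. x \<le> mset_mean X")
  case True
  hence "\<forall>x\<in>#X. x = mset_mean X"
    using sum_mset_eq_iff_pointwise_eq[of X "\<lambda>x. x" "\<lambda>_. mset_mean X"]
    by (simp add: size_times_mset_mean)
  thus ?thesis using that assms by (metis multiset_nonemptyE order_refl)
qed (use that in force)

lemma sum_abs_diff_le:
  fixes a b :: "'a :: linordered_field"
  shows "(\<Sum>x\<in>#X. \<bar>x - a\<bar>) \<le> (\<Sum>x\<in>#X. \<bar>x - b\<bar>) + of_nat (size X) * \<bar>a - b\<bar>"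
proof -
  have "(\<Sum>x\<in>#X. \<bar>x - a\<bar>) \<le> (\<Sum>x\<in>#X. \<bar>x - b\<bar> + \<bar>a - b\<bar>)"
    by (intro sum_mset_mono) linarith
  thus ?thesis by (simp add: sum_mset.distrib)
qed

lemma sum_abs_diff_eq_iff:
  fixes a b :: "'a :: linordered_field"
  shows "(\<Sum>x\<in>#X. \<bar>x - a\<bar>) = (\<Sum>x\<in>#X. \<bar>x - b\<bar>) + of_nat (size X) * \<bar>a - b\<bar> \<longleftrightarrow>
    (\<forall>x\<in>#X. \<bar>x - a\<bar> = \<bar>x - b\<bar> + \<bar>a - b\<bar>)"
proof -
  have "\<bar>x - a\<bar> \<le> \<bar>x - b\<bar> + \<bar>a - b\<bar>" for x by linarith
  from sum_mset_eq_iff_pointwise_eq[of X, OF this] show ?thesis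
    by (simp add: sum_mset.distrib)
qed

lemma total_deviation_less_sum_abs_diff:
  assumes "X \<noteq> {#}" and "b < mset_mean X"
  shows "total_deviation X < (\<Sum>x\<in>#X. \<bar>x - b\<bar>) + of_nat (size X) * (mset_mean X - b)"
proof -
  let ?a = "mset_mean X"
  obtain x where "x \<in># X" "?a \<le> x" using \<open>X \<noteq> {#}\<close> by (rule ex_ge_mset_mean)
  moreover have "\<bar>x - ?a\<bar> \<noteq> \<bar>x - b\<bar> + \<bar>?a - b\<bar>"
    using \<open>?a \<le> x\<close> \<open>b < ?a\<close> by linarith
  ultimately have "(\<Sum>x\<in>#X. \<bar>x - ?a\<bar>) \<noteq> (\<Sum>x\<in>#X. \<bar>x - b\<bar>) + of_nat (size X) * \<bar>?a - b\<bar>"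
    unfolding sum_abs_diff_eq_iff by blast
  thus ?thesis
    using sum_abs_diff_le[of ?a X b] \<open>b < ?a\<close> by (simp add: total_deviation_def)
qed

lemma sum_abs_diff_le_total_deviation:
  assumes "b \<le> mset_mean X"
  shows "(\<Sum>x\<in>#X. \<bar>x - b\<bar>) \<le> total_deviation X + of_nat (size X) * (mset_mean X - b)"
  using sum_abs_diff_le[of b X "mset_mean X"] assms by (simp add: total_deviation_def)

lemma sum_abs_diff_eq_total_deviation_iff:
  assumes "b < mset_mean X"
  shows "(\<Sum>x\<in>#X. \<bar>x - b\<bar>) = total_deviation X + of_nat (size X) * (mset_mean X - b) \<longleftrightarrow>
    (\<forall>x\<in>#X. x = mset_mean X)"
proof -
  let ?a = "mset_mean X"
  have "(\<Sum>x\<in>#X. \<bar>x - b\<bar>) = total_deviation X + of_nat (size X) * (?a - b) \<longleftrightarrow>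
      (\<forall>x\<in>#X. \<bar>x - b\<bar> = \<bar>x - ?a\<bar> + \<bar>b - ?a\<bar>)"
    using sum_abs_diff_eq_iff[of b X ?a] assms by (simp add: total_deviation_def)
  also have "\<dots> \<longleftrightarrow> (\<forall>x\<in>#X. ?a \<le> x)"
    using assms by (intro ball_cong refl) linarith
  also have "\<dots> \<longleftrightarrow> (\<forall>x\<in>#X. x = ?a)" by (rule all_ge_mset_mean_iff)
  finally show ?thesis .
qed

lemma mset_mean_add_zeros:
  fixes X :: "'a :: linordered_field multiset"
  assumes "0 < mset_mean X" and "0 < r"
  defines "Y \<equiv> X + replicate_mset r 0"
  shows "of_nat (size X) * (mset_mean X - mset_mean Y) = of_nat r * mset_mean Y"
    and "0 < mset_mean Y" and "mset_mean Y < mset_mean X"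
proof -
  have "(of_nat (size X) + of_nat r) * mset_mean Y = of_nat (size X) * mset_mean X"
    using size_times_mset_mean[of Y] size_times_mset_mean[of X] by (simp add: Y_def)
  thus difference: "of_nat (size X) * (mset_mean X - mset_mean Y) = of_nat r * mset_mean Y"
    by (simp add: algebra_simps)
  have "X \<noteq> {#}" using assms(1) by (auto simp: mset_mean_def)
  hence "0 < \<Sum>\<^sub># X"
    using assms(1) by (simp add: mset_mean_def zero_less_divide_iff)
  thus "0 < mset_mean Y"
    using \<open>0 < r\<close> by (simp add: mset_mean_def Y_def zero_less_divide_iff flip: of_nat_add)
  hence "0 < of_nat (size X) * (mset_mean X - mset_mean Y)" using difference \<open>0 < r\<close> by simp
  thus "mset_mean Y < mset_mean X" by (simp add: zero_less_mult_iff)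
qed

lemma total_deviation_add_zeros_bounds:
  fixes X :: "'a :: linordered_field multiset"
  assumes "0 < mset_mean X" and "0 < r"
  defines "Y \<equiv> X + replicate_mset r 0"
  shows "total_deviation X < total_deviation Y"
    and "total_deviation Y \<le> total_deviation X + 2 * of_nat r * mset_mean Y"
    and "total_deviation Y = total_deviation X + 2 * of_nat r * mset_mean Y \<longleftrightarrow>
      (\<forall>x\<in>#X. x = mset_mean X)"
proof -
  let ?b = "mset_mean Y"
  note means = mset_mean_add_zeros[OF assms(1,2), folded Y_def]
  have "X \<noteq> {#}" using assms(1) by (auto simp: mset_mean_def)
  have deviation_Y: "total_deviation Y = (\<Sum>x\<in>#X. \<bar>x - ?b\<bar>) + of_nat r * ?b"
    unfolding total_deviation_def using means(2) by (subst Y_def) simp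
  show "total_deviation X < total_deviation Y"
    using total_deviation_less_sum_abs_diff[OF \<open>X \<noteq> {#}\<close> means(3)]
    by (simp add: deviation_Y means(1))
  show "total_deviation Y \<le> total_deviation X + 2 * of_nat r * ?b"
    using sum_abs_diff_le_total_deviation[of ?b X] means(3)
    by (simp add: deviation_Y means(1) mult.assoc)
  show "total_deviation Y = total_deviation X + 2 * of_nat r * ?b \<longleftrightarrow>
      (\<forall>x\<in>#X. x = mset_mean X)"
    using sum_abs_diff_eq_total_deviation_iff[OF means(3)]
    by (simp add: deviation_Y means(1) mult.assoc add.commute)
qed


section \<open>Characteristic polynomials\<close>

lemma char_poly_nonzero:
  fixes A :: "'a :: idom mat"
  shows "A \<in> carrier_mat n n \<Longrightarrow> char_poly A \<noteq> 0"
  using degree_monic_char_poly[of A n] by auto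

lemma proots_linear_factors: "proots (\<Prod>a\<leftarrow>as. [:- a, 1:]) = mset (as :: 'a :: idom list)"
proof (induction as)
  case (Cons a as)
  have "(\<Prod>a\<leftarrow>as. [:- a, 1:]) \<noteq> (0 :: 'a poly)" by (auto simp: prod_list_zero_iff)
  with Cons show ?case by (simp add: proots_mult del: mult_pCons_left)
qed simp

lemma proots_eq_empty:
  assumes "\<And>x. poly p x \<noteq> 0"
  shows "proots p = {#}"
  using assms by (cases "p = 0") (auto simp: multiset_eq_iff order_root)

lemma proots_pcompose_shift:
  fixes p :: "'a :: idom poly"
  shows "proots (p \<circ>\<^sub>p [:- c, 1:]) = image_mset (\<lambda>x. x + c) (proots p)"
proof (induction p rule: poly_root_order_induct)
  case (no_roots p)
  thus ?case by (simp add: proots_eq_empty poly_pcompose)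
next
  case (root p x n)
  have "p \<noteq> 0" using root.hyps by auto
  hence "p \<circ>\<^sub>p [:- c, 1:] \<noteq> 0" by (simp add: pcompose_eq_0_iff)
  moreover have "[:- x, 1:] \<circ>\<^sub>p [:- c, 1:] = [:- (x + c), 1:]"
    by (simp add: pcompose_pCons)
  hence "([:- x, 1:] ^ n * p) \<circ>\<^sub>p [:- c, 1:] = [:- (x + c), 1:] ^ n * (p \<circ>\<^sub>p [:- c, 1:])"
    by (simp add: pcompose_mult pcompose_hom.hom_power)
  ultimately show ?case
    using \<open>p \<noteq> 0\<close> root.IH by (simp add: proots_mult proots_power del: minus_add_distrib)
qed simp

lemma char_poly_add_scalar:
  fixes A :: "'a :: comm_ring_1 mat"
  assumes "A \<in> carrier_mat n n"
  shows "char_poly (A + c \<cdot>\<^sub>m 1\<^sub>m n) = char_poly A \<circ>\<^sub>p [:- c, 1:]"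
proof -
  have "char_poly_matrix (A + c \<cdot>\<^sub>m 1\<^sub>m n) = map_mat (\<lambda>p. p \<circ>\<^sub>p [:- c, 1:]) (char_poly_matrix A)"
    using assms by (intro eq_matI) (auto simp: char_poly_matrix_def pcompose_add pcompose_pCons)
  thus ?thesis
    by (simp add: char_poly_def comm_ring_hom.hom_det[OF pcompose_hom.comm_ring_hom_axioms])
qed

lemma eigenvalues_add_scalar:
  assumes "A \<in> carrier_mat n n"
  shows "eigenvalues (A + c \<cdot>\<^sub>m 1\<^sub>m n) = image_mset (\<lambda>x. x + c) (eigenvalues A)"
  by (simp add: eigenvalues_def char_poly_add_scalar[OF assms] proots_pcompose_shift)

lemma sylvester_determinant_identity:
  fixes A B :: "'a :: idom mat"
  assumes A: "A \<in> carrier_mat n m" and B: "B \<in> carrier_mat m n"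
  shows "x ^ m * det (x \<cdot>\<^sub>m 1\<^sub>m n - A * B) = x ^ n * det (x \<cdot>\<^sub>m 1\<^sub>m m - B * A)"
proof -
  let ?M = "four_block_mat (x \<cdot>\<^sub>m 1\<^sub>m n) A B (1\<^sub>m m)"
  let ?L = "four_block_mat (1\<^sub>m n) (0\<^sub>m n m) (- B) (x \<cdot>\<^sub>m 1\<^sub>m m)"
  let ?R = "four_block_mat (1\<^sub>m n) (0\<^sub>m n m) (- B) (1\<^sub>m m)"
  have upper_left: "?M * ?R = four_block_mat (x \<cdot>\<^sub>m 1\<^sub>m n - A * B) A (0\<^sub>m m n) (1\<^sub>m m)"
    using A B by (subst mult_four_block_mat[of _ n n _ m _ m _ _ n _ m]) auto
  have "det (?M * ?R) = det (x \<cdot>\<^sub>m 1\<^sub>m n - A * B)"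
    unfolding upper_left using A B by (subst det_four_block_mat_lower_left_zero[of _ n _ m]) auto
  moreover have "det (?M * ?R) = det ?M * det ?R"
    using A B by (intro det_mult[of _ "n + m"]) auto
  moreover have "det ?R = 1"
    using B by (subst det_four_block_mat_upper_right_zero[of _ n _ m]) auto
  ultimately have det_M: "det ?M = det (x \<cdot>\<^sub>m 1\<^sub>m n - A * B)" by simp
  have lower_right: "?L * ?M = four_block_mat (x \<cdot>\<^sub>m 1\<^sub>m n) A (0\<^sub>m m n) (x \<cdot>\<^sub>m 1\<^sub>m m - B * A)"
    using A B by (subst mult_four_block_mat[of _ n n _ m _ m _ _ n _ m]) auto
  have "det (?L * ?M) = x ^ n * det (x \<cdot>\<^sub>m 1\<^sub>m m - B * A)"
    unfolding lower_right using A B by (subst det_four_block_mat_lower_left_zero[of _ n _ m]) auto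
  moreover have "det (?L * ?M) = det ?L * det ?M"
    using A B by (intro det_mult[of _ "n + m"]) auto
  moreover have "det ?L = x ^ m"
    using B by (subst det_four_block_mat_upper_right_zero[of _ n _ m]) auto
  ultimately show ?thesis using det_M by simp
qed

lemma char_poly_matrix_mult:
  fixes A B :: "'a :: comm_ring_1 mat"
  assumes "A \<in> carrier_mat n m" and "B \<in> carrier_mat m n"
  shows "char_poly_matrix (A * B) =
    [:0, 1:] \<cdot>\<^sub>m 1\<^sub>m n - map_mat (\<lambda>a. [:a:]) A * map_mat (\<lambda>a. [:a:]) B"
proof -
  have "char_poly_matrix (A * B) = [:0, 1:] \<cdot>\<^sub>m 1\<^sub>m n - map_mat (\<lambda>a. [:a:]) (A * B)"
    using assms by (intro eq_matI) (auto simp: char_poly_matrix_def)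
  thus ?thesis by (simp add: map_poly_mult(1)[OF assms])
qed

lemma char_poly_mult_commute:
  fixes A B :: "'a :: idom mat"
  assumes A: "A \<in> carrier_mat n m" and B: "B \<in> carrier_mat m n" and "m \<le> n"
  shows "char_poly (A * B) = [:0, 1:] ^ (n - m) * char_poly (B * A)"
proof -
  have "[:0, 1:] ^ m * char_poly (A * B) = [:0, 1:] ^ n * char_poly (B * A)"
    using A B unfolding char_poly_def char_poly_matrix_mult[OF A B] char_poly_matrix_mult[OF B A]
    by (intro sylvester_determinant_identity) auto
  also have "\<dots> = [:0, 1:] ^ m * ([:0, 1:] ^ (n - m) * char_poly (B * A))"
    using \<open>m \<le> n\<close> by (metis le_add_diff_inverse mult.assoc power_add)
  finally show ?thesis by (subst (asm) mult_left_cancel) auto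
qed

lemma eigenvalues_mult_commute:
  assumes "A \<in> carrier_mat n m" and "B \<in> carrier_mat m n" and "m \<le> n"
  shows "eigenvalues (A * B) = eigenvalues (B * A) + replicate_mset (n - m) 0"
proof -
  have "proots ([:0, 1:] ^ r :: real poly) = replicate_mset r 0" for r
    by (simp add: proots_power multiset_eq_iff)
  moreover have "char_poly (B * A) \<noteq> 0"
    using assms by (intro char_poly_nonzero) auto
  ultimately show ?thesis
    unfolding eigenvalues_def char_poly_mult_commute[OF assms]
    by (simp add: proots_mult union_commute)
qed


section \<open>Traces of powers\<close>

definition mat_trace :: "'a :: comm_monoid_add mat \<Rightarrow> 'a" where
  "mat_trace A = (\<Sum>i<dim_row A. A $$ (i, i))"

lemma mat_trace_mult:
  assumes "A \<in> carrier_mat n m" and "B \<in> carrier_mat m n"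
  shows "mat_trace (A * B) = (\<Sum>i<n. \<Sum>j<m. A $$ (i, j) * B $$ (j, i))"
  using assms by (auto simp: mat_trace_def scalar_prod_def atLeast0LessThan)

lemma mat_trace_mult_commute:
  fixes A B :: "'a :: comm_semiring_0 mat"
  assumes "A \<in> carrier_mat n m" and "B \<in> carrier_mat m n"
  shows "mat_trace (A * B) = mat_trace (B * A)"
  unfolding mat_trace_mult[OF assms] mat_trace_mult[OF assms(2,1)]
  by (subst sum.swap) (simp add: mult.commute)

lemma mat_trace_similar:
  fixes A B :: "'a :: comm_semiring_1 mat"
  assumes "similar_mat A B"
  shows "mat_trace A = mat_trace B"
proof -
  obtain n P Q where carrier: "{A, B, P, Q} \<subseteq> carrier_mat n n" and inverse: "Q * P = 1\<^sub>m n"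
    and A: "A = P * B * Q"
    using similar_matD[OF assms] by blast
  have "mat_trace A = mat_trace (Q * (P * B))"
    unfolding A using carrier by (intro mat_trace_mult_commute) auto
  also have "Q * (P * B) = B"
    using carrier inverse by (metis assoc_mult_mat insert_subset left_mult_one_mat)
  finally show ?thesis .
qed

lemma upper_triangular_mult_index:
  assumes A: "A \<in> carrier_mat n n" "upper_triangular A"
    and B: "B \<in> carrier_mat n n" "upper_triangular B"
    and "i < n" and "j \<le> i"
  shows "(A * B) $$ (i, j) = (if i = j then A $$ (i, i) * B $$ (i, i) else 0)"
proof -
  have "(A * B) $$ (i, j) = (\<Sum>l<n. A $$ (i, l) * B $$ (l, j))"
    using assms by (simp add: scalar_prod_def atLeast0LessThan)
  also have "\<dots> = (\<Sum>l<n. if l = i then if i = j then A $$ (i, i) * B $$ (i, i) else 0 else 0)"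
  proof (rule sum.cong)
    fix l assume "l \<in> {..<n}"
    thus "A $$ (i, l) * B $$ (l, j) =
        (if l = i then if i = j then A $$ (i, i) * B $$ (i, i) else 0 else 0)"
      using assms by (cases l i rule: linorder_cases) (auto simp: upper_triangularD)
  qed simp
  finally show ?thesis using \<open>i < n\<close> by simp
qed

lemma upper_triangular_pow:
  fixes A :: "'a :: semiring_1 mat"
  assumes A: "A \<in> carrier_mat n n" "upper_triangular A"
  shows "upper_triangular (A ^\<^sub>m k)" and "i < n \<Longrightarrow> (A ^\<^sub>m k) $$ (i, i) = A $$ (i, i) ^ k"
proof -
  have "upper_triangular (A ^\<^sub>m k) \<and> (\<forall>i<n. (A ^\<^sub>m k) $$ (i, i) = A $$ (i, i) ^ k)"
  proof (induction k)
    case (Suc k)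
    note index = upper_triangular_mult_index[OF pow_carrier_mat[OF A(1), of k] _ A]
    show ?case
      using Suc A(1)
      by (auto simp: index power_Suc2 simp del: index_mult_mat(1) power_Suc
          intro!: upper_triangularI)
  qed (use A in auto)
  thus "upper_triangular (A ^\<^sub>m k)" "i < n \<Longrightarrow> (A ^\<^sub>m k) $$ (i, i) = A $$ (i, i) ^ k"
    by auto
qed

lemma mat_trace_pow:
  fixes A :: "'a :: conjugatable_ordered_field mat"
  assumes A: "A \<in> carrier_mat n n" and splits: "char_poly A = (\<Prod>a\<leftarrow>as. [:- a, 1:])"
  shows "mat_trace (A ^\<^sub>m k) = (\<Sum>a\<leftarrow>as. a ^ k)"
proof -
  obtain T where T: "T \<in> carrier_mat n n" "upper_triangular T" and similar: "similar_mat A T"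
    using schur_decomposition_exists[OF assms] by blast
  have "(\<Prod>a\<leftarrow>diag_mat T. [:- a, 1:]) = (\<Prod>a\<leftarrow>as. [:- a, 1:])"
    unfolding char_poly_upper_triangular[OF T, symmetric] splits[symmetric]
    by (rule char_poly_similar[OF similar, symmetric])
  hence diag: "mset (diag_mat T) = mset as"
    by (metis proots_linear_factors)
  have "similar_mat (A ^\<^sub>m k) (T ^\<^sub>m k)"
    using similar similar_mat_wit_pow unfolding similar_mat_def by blast
  hence "mat_trace (A ^\<^sub>m k) = mat_trace (T ^\<^sub>m k)" by (rule mat_trace_similar)
  also have "\<dots> = (\<Sum>a\<leftarrow>diag_mat T. a ^ k)"
    using T by (simp add: mat_trace_def diag_mat_def upper_triangular_pow sum_list_sum_nth
        atLeast0LessThan)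
  also have "\<dots> = (\<Sum>a\<leftarrow>as. a ^ k)"
    using diag by (metis mset_map sum_mset_sum_list)
  finally show ?thesis .
qed


section \<open>Real symmetric matrices\<close>

lemma hermitian_eigenvalue_conjugate:
  fixes A :: "'a :: conjugatable_ordered_field mat"
  assumes A: "A \<in> carrier_mat n n" and hermitian: "map_mat conjugate A = A\<^sup>T"
    and "eigenvalue A a"
  shows "conjugate a = a"
proof -
  obtain v where v: "v \<in> carrier_vec n" "v \<noteq> 0\<^sub>v n" and eigen: "A *\<^sub>v v = a \<cdot>\<^sub>v v"
    using \<open>eigenvalue A a\<close> A unfolding eigenvalue_def eigenvector_def by auto
  have "A\<^sup>T *\<^sub>v conjugate v = conjugate (A *\<^sub>v v)"
    unfolding hermitian[symmetric] using A v
    by (intro eq_vecI) (auto simp: scalar_prod_def sum_conjugate conjugate_dist_mul)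
  hence eigen_conjugate: "A\<^sup>T *\<^sub>v conjugate v = conjugate a \<cdot>\<^sub>v conjugate v"
    by (simp add: eigen conjugate_smult_vec)
  have "a * (v \<bullet>c v) = (A *\<^sub>v v) \<bullet>c v"
    using v by (simp add: eigen)
  also have "\<dots> = (A\<^sup>T *\<^sub>v conjugate v) \<bullet> v"
    using A v transpose_vec_mult_scalar[OF A v(1), of "conjugate v"]
    by (simp add: comm_scalar_prod[of "A *\<^sub>v v" n])
  also have "\<dots> = conjugate a * (v \<bullet>c v)"
    using v by (simp add: eigen_conjugate comm_scalar_prod[of v n])
  finally show ?thesis using v by simp
qed

lemma symmetric_char_poly_splits:
  fixes M :: "real mat"
  assumes M: "M \<in> carrier_mat n n" and symmetric: "M\<^sup>T = M"
  obtains as where "char_poly M = (\<Prod>a\<leftarrow>as. [:- a, 1:])"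
proof -
  let ?A = "map_mat complex_of_real M"
  have A: "?A \<in> carrier_mat n n" using M by simp
  have "map_mat conjugate ?A = ?A" by (intro eq_matI) auto
  also have "\<dots> = ?A\<^sup>T" by (subst symmetric[symmetric]) (intro eq_matI, auto)
  finally have hermitian: "map_mat conjugate ?A = ?A\<^sup>T" .
  obtain as where as: "char_poly ?A = (\<Prod>a\<leftarrow>as. [:- a, 1:])"
    using char_poly_factorized[OF A] by blast
  have real: "complex_of_real (Re a) = a" if "a \<in> set as" for a
  proof -
    have "poly (char_poly ?A) a = 0" unfolding as
      using that by (auto simp: poly_prod_list prod_list_zero_iff)
    hence "eigenvalue ?A a" by (simp add: eigenvalue_root_char_poly[OF A])
    thus ?thesis
      using hermitian_eigenvalue_conjugate[OF A hermitian] by (simp add: Reals_cnj_iff)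
  qed
  interpret of_real_poly: map_poly_inj_comm_ring_hom complex_of_real ..
  have "map_poly complex_of_real (char_poly M) = (\<Prod>a\<leftarrow>as. [:- a, 1:])"
    using as by (simp add: of_real_hom.char_poly_hom[OF M])
  also have "\<dots> = (\<Prod>a\<leftarrow>map Re as. map_poly complex_of_real [:- a, 1:])"
    by (rule arg_cong[where f = prod_list]) (auto simp: real)
  also have "\<dots> = map_poly complex_of_real (\<Prod>a\<leftarrow>map Re as. [:- a, 1:])"
    by (simp add: of_real_poly.hom_prod_list o_def)
  finally show thesis using of_real_poly.injectivity that by blast
qed

lemma size_eigenvalues_symmetric:
  assumes M: "M \<in> carrier_mat n n" and "M\<^sup>T = M"
  shows "size (eigenvalues M) = n"
proof -
  obtain as where splits: "char_poly M = (\<Prod>a\<leftarrow>as. [:- a, 1:])"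
    using assms by (rule symmetric_char_poly_splits)
  have "length as = n"
    using degree_monic_char_poly[OF M] degree_linear_factors[of uminus as] by (simp add: splits)
  thus ?thesis by (simp add: eigenvalues_def splits proots_linear_factors)
qed

lemma sum_eigenvalues_power_symmetric:
  assumes "M \<in> carrier_mat n n" and "M\<^sup>T = M"
  shows "(\<Sum>x\<in>#eigenvalues M. x ^ k) = mat_trace (M ^\<^sub>m k)"
proof -
  obtain as where splits: "char_poly M = (\<Prod>a\<leftarrow>as. [:- a, 1:])"
    using assms by (rule symmetric_char_poly_splits)
  thus ?thesis
    by (simp add: eigenvalues_def proots_linear_factors mat_trace_pow[OF assms(1) splits]
        flip: sum_mset_sum_list)
qed

lemma mset_mean_eigenvalues_symmetric:
  assumes "M \<in> carrier_mat n n" and "M\<^sup>T = M"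
  shows "mset_mean (eigenvalues M) = mat_trace M / real n"
  using sum_eigenvalues_power_symmetric[OF assms, of 1] assms(1)
  by (simp add: mset_mean_def size_eigenvalues_symmetric[OF assms])

lemma sum_squared_eigenvalues_symmetric:
  assumes M: "M \<in> carrier_mat n n" and symmetric: "M\<^sup>T = M"
  shows "(\<Sum>x\<in>#eigenvalues M. x\<^sup>2) = (\<Sum>i<n. \<Sum>j<n. (M $$ (i, j))\<^sup>2)"
proof -
  have "(\<Sum>x\<in>#eigenvalues M. x\<^sup>2) = mat_trace (M * M\<^sup>T)"
    unfolding sum_eigenvalues_power_symmetric[OF assms] symmetric
    using M by (simp add: numeral_2_eq_2)
  also have "\<dots> = (\<Sum>i<n. \<Sum>j<n. (M $$ (i, j))\<^sup>2)"
    using M by (subst mat_trace_mult[of _ n n]) (auto simp: power2_eq_square)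
  finally show ?thesis .
qed

lemma eigenvalues_symmetric_all_0_iff:
  assumes M: "M \<in> carrier_mat n n" and "M\<^sup>T = M"
  shows "(\<forall>x\<in>#eigenvalues M. x = 0) \<longleftrightarrow> M = 0\<^sub>m n n"
proof -
  have "(\<forall>x\<in>#eigenvalues M. x = 0) \<longleftrightarrow> (\<Sum>x\<in>#eigenvalues M. x\<^sup>2) = 0"
    using sum_mset_eq_iff_pointwise_eq[of "eigenvalues M" "\<lambda>_. 0" power2] by auto
  also have "\<dots> \<longleftrightarrow> (\<forall>i<n. \<forall>j<n. M $$ (i, j) = 0)"
    by (simp add: sum_squared_eigenvalues_symmetric[OF assms] sum_nonneg_eq_0_iff sum_nonneg
        Ball_def)
  also have "\<dots> \<longleftrightarrow> M = 0\<^sub>m n n" using M by (auto intro!: eq_matI)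
  finally show ?thesis .
qed

lemma eigenvalues_symmetric_all_eq_iff:
  assumes M: "M \<in> carrier_mat n n" and symmetric: "M\<^sup>T = M"
  shows "(\<forall>x\<in>#eigenvalues M. x = c) \<longleftrightarrow> M = c \<cdot>\<^sub>m 1\<^sub>m n"
proof -
  define N where "N = M + (- c) \<cdot>\<^sub>m 1\<^sub>m n"
  have N: "N \<in> carrier_mat n n" using M by (simp add: N_def)
  have "((- c) \<cdot>\<^sub>m 1\<^sub>m n)\<^sup>T = (- c) \<cdot>\<^sub>m 1\<^sub>m n" by (intro eq_matI) auto
  hence "N\<^sup>T = N"
    using M symmetric by (simp add: N_def transpose_add[of _ n n])
  have "(\<forall>x\<in>#eigenvalues M. x = c) \<longleftrightarrow> (\<forall>x\<in>#eigenvalues N. x = 0)"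
    by (auto simp: N_def eigenvalues_add_scalar[OF M])
  also have "\<dots> \<longleftrightarrow> N = 0\<^sub>m n n"
    using N \<open>N\<^sup>T = N\<close> by (rule eigenvalues_symmetric_all_0_iff)
  also have "\<dots> \<longleftrightarrow> M = c \<cdot>\<^sub>m 1\<^sub>m n"
    using M by (auto simp: N_def mat_eq_iff)
  finally show ?thesis .
qed


section \<open>Hypergraphs\<close>

definition edge_gram :: "'a list \<Rightarrow> 'a set list \<Rightarrow> real mat" where
  "edge_gram vs es = (incidence_matrix vs es)\<^sup>T * incidence_matrix vs es"

lemma incidence_matrix_carrier [simp]:
  "incidence_matrix vs es \<in> carrier_mat (length vs) (length es)"
  by (simp add: incidence_matrix_def)

lemma line_adjacency_matrix_carrier [simp]:
  "line_adjacency_matrix es \<in> carrier_mat (length es) (length es)"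
  by (simp add: line_adjacency_matrix_def)

lemma signless_laplacian_carrier [simp]:
  "signless_laplacian vs es \<in> carrier_mat (length vs) (length vs)"
  by (simp add: signless_laplacian_def incidence_matrix_def carrier_matI)

lemma edge_gram_carrier [simp]: "edge_gram vs es \<in> carrier_mat (length es) (length es)"
  by (simp add: edge_gram_def incidence_matrix_def carrier_matI)

lemma transpose_mult_transpose:
  fixes A :: "'a :: comm_semiring_0 mat"
  shows "(A * A\<^sup>T)\<^sup>T = A * A\<^sup>T"
  by (subst transpose_mult[of _ _ "dim_col A" _ "dim_row A"]) auto

lemma signless_laplacian_symmetric: "(signless_laplacian vs es)\<^sup>T = signless_laplacian vs es"
  by (simp add: signless_laplacian_def transpose_mult_transpose)

lemma edge_gram_symmetric: "(edge_gram vs es)\<^sup>T = edge_gram vs es"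
  using transpose_mult_transpose[of "(incidence_matrix vs es)\<^sup>T"] by (simp add: edge_gram_def)

lemma mat_trace_signless_laplacian:
  "mat_trace (signless_laplacian vs es) = mat_trace (edge_gram vs es)"
  unfolding signless_laplacian_def edge_gram_def by (rule mat_trace_mult_commute) auto

lemma eigenvalues_signless_laplacian:
  assumes "length es \<le> length vs"
  shows "eigenvalues (signless_laplacian vs es) =
    eigenvalues (edge_gram vs es) + replicate_mset (length vs - length es) 0"
  unfolding signless_laplacian_def edge_gram_def
  using assms by (intro eigenvalues_mult_commute) auto

lemma eigenvalues_edge_gram:
  assumes "length vs \<le> length es"
  shows "eigenvalues (edge_gram vs es) =
    eigenvalues (signless_laplacian vs es) + replicate_mset (length es - length vs) 0"
  unfolding signless_laplacian_def edge_gram_def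
  using assms by (intro eigenvalues_mult_commute) auto

lemma line_adjacency_matrix_symmetric: "(line_adjacency_matrix es)\<^sup>T = line_adjacency_matrix es"
  by (intro eq_matI) (auto simp: line_adjacency_matrix_def Int_commute)

lemma line_adjacency_matrix_eq_0_iff:
  assumes "distinct es" and "\<forall>e\<in>set es. finite e"
  shows "line_adjacency_matrix es = 0\<^sub>m (length es) (length es) \<longleftrightarrow> pairwise disjnt (set es)"
proof -
  have "line_adjacency_matrix es = 0\<^sub>m (length es) (length es) \<longleftrightarrow>
      (\<forall>i<length es. \<forall>j<length es. i \<noteq> j \<longrightarrow> disjnt (es ! i) (es ! j))"
    using assms(2) by (auto simp: mat_eq_iff line_adjacency_matrix_def disjnt_def)
  also have "\<dots> \<longleftrightarrow> pairwise disjnt (set es)"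
    using assms(1) by (simp add: pairwise_def all_set_conv_all_nth nth_eq_iff_index_eq)
  finally show ?thesis .
qed

lemma sum_indicator_nth:
  assumes "distinct xs" and "A \<subseteq> set xs"
  shows "(\<Sum>i<length xs. if xs ! i \<in> A then 1 else 0) = (of_nat (card A) :: 'b :: semiring_1)"
proof -
  have "(\<Sum>i<length xs. if xs ! i \<in> A then 1 else 0) = (\<Sum>x\<in>set xs. if x \<in> A then 1 else 0 :: 'b)"
    using assms(1) by (intro sum.reindex_bij_betw bij_betw_nth) auto
  also have "\<dots> = of_nat (card (set xs \<inter> A))" by (simp add: sum.If_cases)
  finally show ?thesis using assms(2) by (simp add: inf_absorb2)
qed

lemma edge_gram_index:
  assumes "distinct vs" and "es ! i \<subseteq> set vs" and "i < length es" and "j < length es"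
  shows "edge_gram vs es $$ (i, j) = real (card (es ! i \<inter> es ! j))"
proof -
  have "edge_gram vs es $$ (i, j) =
      (\<Sum>l<length vs. if vs ! l \<in> es ! i \<inter> es ! j then 1 else 0)"
    using assms by (auto simp: edge_gram_def incidence_matrix_def scalar_prod_def atLeast0LessThan
        intro!: sum.cong)
  also have "\<dots> = real (card (es ! i \<inter> es ! j))"
    using assms by (intro sum_indicator_nth) auto
  finally show ?thesis .
qed

lemma signless_laplacian_index:
  assumes "i < length vs" and "j < length vs"
  shows "signless_laplacian vs es $$ (i, j) =
    real (card {l. l < length es \<and> vs ! i \<in> es ! l \<and> vs ! j \<in> es ! l})"
proof -
  have "signless_laplacian vs es $$ (i, j) =
      (\<Sum>l<length es. if vs ! i \<in> es ! l \<and> vs ! j \<in> es ! l then 1 else 0)"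
    using assms unfolding signless_laplacian_def
    by (auto simp: incidence_matrix_def scalar_prod_def atLeast0LessThan intro!: sum.cong)
  also have "\<dots> = real (card {l. l < length es \<and> vs ! i \<in> es ! l \<and> vs ! j \<in> es ! l})"
    by (simp add: sum.If_cases Int_def)
  finally show ?thesis .
qed

lemma signless_laplacian_neq_scalar:
  assumes "e \<in> set es" and "e \<subseteq> set vs" and "u \<in> e" and "v \<in> e" and "u \<noteq> v"
  shows "signless_laplacian vs es \<noteq> c \<cdot>\<^sub>m 1\<^sub>m (length vs)"
proof
  assume scalar: "signless_laplacian vs es = c \<cdot>\<^sub>m 1\<^sub>m (length vs)"
  obtain i j where ij: "i < length vs" "j < length vs" "vs ! i = u" "vs ! j = v"
    using assms by (meson in_set_conv_nth subsetD)
  obtain l where "l < length es" "es ! l = e" using assms(1) by (meson in_set_conv_nth)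
  hence "{l. l < length es \<and> vs ! i \<in> es ! l \<and> vs ! j \<in> es ! l} \<noteq> {}"
    using assms ij by blast
  hence "signless_laplacian vs es $$ (i, j) \<noteq> 0"
    using ij by (simp add: signless_laplacian_index)
  moreover have "i \<noteq> j" using ij \<open>u \<noteq> v\<close> by auto
  ultimately show False unfolding scalar using ij by simp
qed

locale enumerated_uniform_hypergraph =
  fixes k :: nat and vs :: "'a list" and es :: "'a set list"
  assumes uniform: "uniform_hypergraph k (set vs) (set es)"
    and distinct_vertices: "distinct vs" and distinct_edges: "distinct es"
    and edges_nonempty: "es \<noteq> []"
begin

lemma
  assumes "e \<in> set es"
  shows edge_subset: "e \<subseteq> set vs" and card_edge: "card e = k" and finite_edge: "finite e"
  using assms uniform finite_subset by (auto simp: uniform_hypergraph_def)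

lemma uniformity_ge_2: "k \<ge> 2"
  using uniform by (simp add: uniform_hypergraph_def)

lemma vertices_nonempty: "vs \<noteq> []"
  using edge_subset[of "hd es"] card_edge[of "hd es"] edges_nonempty uniformity_ge_2 by auto

lemma edge_gram_diagonal: "i < length es \<Longrightarrow> edge_gram vs es $$ (i, i) = real k"
  by (simp add: edge_gram_index distinct_vertices edge_subset card_edge)

lemma edge_gram_eq: "edge_gram vs es = line_adjacency_matrix es + real k \<cdot>\<^sub>m 1\<^sub>m (length es)"
  (is "_ = ?A")
proof (rule eq_matI)
  fix i j
  assume "i < dim_row ?A" and "j < dim_col ?A"
  hence "i < length es" "j < length es" by auto
  thus "edge_gram vs es $$ (i, j) = ?A $$ (i, j)"
    by (cases "i = j") (simp_all add: edge_gram_index distinct_vertices edge_subset card_edge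
        line_adjacency_matrix_def)
qed (use carrier_matD[OF edge_gram_carrier[of vs es]] in simp_all)

lemma eigenvalues_edge_gram_shift:
  "eigenvalues (edge_gram vs es) =
    image_mset (\<lambda>x. x + real k) (eigenvalues (line_adjacency_matrix es))"
  unfolding edge_gram_eq by (simp add: eigenvalues_add_scalar)

lemma mat_trace_edge_gram: "mat_trace (edge_gram vs es) = real k * real (length es)"
  using carrier_matD[OF edge_gram_carrier[of vs es]]
  by (simp add: mat_trace_def edge_gram_diagonal)

lemma mset_mean_eigenvalues_edge_gram: "mset_mean (eigenvalues (edge_gram vs es)) = real k"
  using edges_nonempty
  by (simp add: mset_mean_eigenvalues_symmetric[OF edge_gram_carrier edge_gram_symmetric]
      mat_trace_edge_gram)

lemma mset_mean_eigenvalues_signless_laplacian: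
  "mset_mean (eigenvalues (signless_laplacian vs es)) = average_degree k vs es"
  by (simp add: mset_mean_eigenvalues_symmetric[OF signless_laplacian_carrier
        signless_laplacian_symmetric] mat_trace_signless_laplacian mat_trace_edge_gram
      average_degree_def)

lemma signless_laplacian_energy_eq:
  "signless_laplacian_energy k vs es = total_deviation (eigenvalues (signless_laplacian vs es))"
  by (simp add: signless_laplacian_energy_def total_deviation_def
      mset_mean_eigenvalues_signless_laplacian)

lemma line_energy_eq:
  "matrix_energy (line_adjacency_matrix es) = total_deviation (eigenvalues (edge_gram vs es))"
  unfolding matrix_energy_def total_deviation_def mset_mean_eigenvalues_edge_gram
  by (simp add: eigenvalues_edge_gram_shift multiset.map_comp o_def)

lemma eigenvalues_edge_gram_const_iff:
  "(\<forall>x\<in>#eigenvalues (edge_gram vs es). x = real k) \<longleftrightarrow> pairwise disjnt (set es)"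
proof -
  have "(\<forall>x\<in>#eigenvalues (edge_gram vs es). x = real k) \<longleftrightarrow>
      (\<forall>x\<in>#eigenvalues (line_adjacency_matrix es). x = 0)"
    by (simp add: eigenvalues_edge_gram_shift)
  also have "\<dots> \<longleftrightarrow> line_adjacency_matrix es = 0\<^sub>m (length es) (length es)"
    by (intro eigenvalues_symmetric_all_0_iff line_adjacency_matrix_symmetric) simp
  also have "\<dots> \<longleftrightarrow> pairwise disjnt (set es)"
    using distinct_edges finite_edge by (intro line_adjacency_matrix_eq_0_iff) auto
  finally show ?thesis .
qed

lemma eigenvalues_signless_laplacian_not_const:
  "\<not> (\<forall>x\<in>#eigenvalues (signless_laplacian vs es). x = c)"
proof -
  have edge: "hd es \<in> set es" using edges_nonempty by simp
  hence "\<not> card (hd es) \<le> Suc 0" using card_edge uniformity_ge_2 by fastforce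
  then obtain u v where "u \<in> hd es" "v \<in> hd es" "u \<noteq> v"
    using finite_edge[OF edge] by (auto simp: card_le_Suc0_iff_eq)
  hence "signless_laplacian vs es \<noteq> c \<cdot>\<^sub>m 1\<^sub>m (length vs)"
    using edge edge_subset by (intro signless_laplacian_neq_scalar) auto
  thus ?thesis
    by (subst eigenvalues_symmetric_all_eq_iff[OF signless_laplacian_carrier
          signless_laplacian_symmetric])
qed

lemma line_energy_bounds_if_fewer_edges:
  assumes "length es < length vs"
  defines "QE \<equiv> signless_laplacian_energy k vs es"
    and "EL \<equiv> matrix_energy (line_adjacency_matrix es)"
    and "gap \<equiv> 2 * average_degree k vs es * (real (length vs) - real (length es))"
  shows "QE - gap \<le> EL" and "EL < QE" and "QE - gap = EL \<longleftrightarrow> pairwise disjnt (set es)"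
proof -
  let ?G = "eigenvalues (edge_gram vs es)" and ?r = "length vs - length es"
  have spectrum: "eigenvalues (signless_laplacian vs es) = ?G + replicate_mset ?r 0"
    using assms(1) by (intro eigenvalues_signless_laplacian) simp
  have "0 < mset_mean ?G" "0 < ?r"
    using uniformity_ge_2 assms(1) by (simp_all add: mset_mean_eigenvalues_edge_gram)
  note deviation = total_deviation_add_zeros_bounds[OF this, folded spectrum,
      folded line_energy_eq signless_laplacian_energy_eq, folded QE_def EL_def]
  have gap: "2 * real ?r * mset_mean (eigenvalues (signless_laplacian vs es)) = gap"
    using assms(1) by (simp add: gap_def mset_mean_eigenvalues_signless_laplacian of_nat_diff)
  show "QE - gap \<le> EL" using deviation(2) by (simp add: gap)
  show "EL < QE" by (rule deviation(1))
  have "QE - gap = EL \<longleftrightarrow> QE = EL + gap" by linarith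
  also have "\<dots> \<longleftrightarrow> pairwise disjnt (set es)"
    using deviation(3)
    by (simp add: gap mset_mean_eigenvalues_edge_gram eigenvalues_edge_gram_const_iff)
  finally show "QE - gap = EL \<longleftrightarrow> pairwise disjnt (set es)" .
qed

lemma line_energy_bounds_if_more_edges:
  assumes "length vs < length es"
  defines "QE \<equiv> signless_laplacian_energy k vs es"
    and "EL \<equiv> matrix_energy (line_adjacency_matrix es)"
  shows "QE < EL" and "EL < QE + 2 * real k * (real (length es) - real (length vs))"
proof -
  let ?Q = "eigenvalues (signless_laplacian vs es)" and ?r = "length es - length vs"
  have spectrum: "eigenvalues (edge_gram vs es) = ?Q + replicate_mset ?r 0"
    using assms(1) by (intro eigenvalues_edge_gram) simp
  have "0 < mset_mean ?Q" "0 < ?r"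
    using uniformity_ge_2 vertices_nonempty edges_nonempty assms(1)
    by (simp_all add: mset_mean_eigenvalues_signless_laplacian average_degree_def)
  note deviation = total_deviation_add_zeros_bounds[OF this, folded spectrum,
      folded line_energy_eq signless_laplacian_energy_eq, folded QE_def EL_def]
  show "QE < EL" by (rule deviation(1))
  have "EL \<le> QE + 2 * real ?r * real k" "EL \<noteq> QE + 2 * real ?r * real k"
    using deviation(2,3) eigenvalues_signless_laplacian_not_const
    by (simp_all add: mset_mean_eigenvalues_edge_gram)
  thus "EL < QE + 2 * real k * (real (length es) - real (length vs))"
    using assms(1) by (simp add: of_nat_diff algebra_simps)
qed

end

theorem theorem27:
  fixes V :: "'a set" and E :: "'a set set" and k n m :: nat
    and vs :: "'a list" and es :: "'a set list" and QE EL :: real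
  assumes "uniform_hypergraph k V E"
    and "card V = n" and "card E = m" and "m \<ge> 1"
    and "enumeration vs V" and "enumeration es E"
    and "QE = signless_laplacian_energy k vs es"
    and "EL = matrix_energy (line_adjacency_matrix es)"
  shows "(m = n \<longrightarrow> QE = EL) \<and>
    (m < n \<longrightarrow>
       QE - 2 * real k * real m * (real n - real m) / real n \<le> EL \<and> EL < QE \<and>
       (QE - 2 * real k * real m * (real n - real m) / real n = EL \<longleftrightarrow> pairwise disjnt E)) \<and>
    (m > n \<longrightarrow> QE < EL \<and> EL < QE + 2 * real k * (real m - real n))"
proof -
  have lists: "set vs = V" "set es = E" "distinct vs" "distinct es"
    using \<open>enumeration vs V\<close> \<open>enumeration es E\<close> by (simp_all add: enumeration_def)
  have lengths: "length vs = n" "length es = m"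
    using lists \<open>card V = n\<close> \<open>card E = m\<close> by (metis distinct_card)+
  interpret enumerated_uniform_hypergraph k vs es
    using lists lengths \<open>uniform_hypergraph k V E\<close> \<open>m \<ge> 1\<close> by unfold_locales auto
  consider (equal) "m = n" | (fewer) "m < n" | (more) "m > n" by linarith
  thus ?thesis
  proof cases
    case equal
    thus ?thesis using eigenvalues_signless_laplacian[of es vs] lengths
      by (simp add: \<open>QE = _\<close> \<open>EL = _\<close> signless_laplacian_energy_eq line_energy_eq)
  next
    case fewer
    thus ?thesis using line_energy_bounds_if_fewer_edges lengths lists
      by (simp add: \<open>QE = _\<close> \<open>EL = _\<close> average_degree_def mult.assoc)
  next
    case more
    thus ?thesis using line_energy_bounds_if_more_edges lengths
      by (simp add: \<open>QE = _\<close> \<open>EL = _\<close>)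
  qed
qed

end
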